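(* Let $\Gamma$ be a type environment, $e$ a $\lambda_D$ term, and suppose $\Gamma \vdash e : \tau\,\langle \mu_\alpha,\sigma_\alpha\rangle\,\alpha\,\langle \mu_\beta,\sigma_\beta\rangle\,\beta$ is derivable in the type system of $\lambda_D$. Then for every environment $\rho$ that respects $\Gamma^*$ (i.e. $\vdash \rho(x) : \Gamma^*(x)$ in $\lambda_C$ for every variable $x$ in the domain of $\Gamma$), one has in $\lambda_C$ $$\Gamma^* \vdash \mathcal{E}[\![e]\!]\,\rho : (\tau^* \to \mu_\alpha^* \to \sigma_\alpha^* \to \alpha^* ) \to \mu_\beta^* \to \sigma_\beta^* \to \beta^*.$$
   Context: **Source language $\lambda_D$** (call-by-value, left-to-right). Values $v ::= n \mid x \mid \lambda x.e$ ($n$ a number). Terms $e ::= v \mid e_1\,e_2 \mid \mathcal{S}k.e$ (shift) $\mid \mathcal{F}k.e$ (control) $\mid \mathcal{S}_0k.e$ (shift0) $\mid \mathcal{F}_0k.e$ (control0) $\mid \langle e\rangle$ (delimiter). Types: value/term types $\tau,\alpha,\beta,\dots ::= \mathbb{N} \mid \tau_1\to\tau_2\,\langle\mu_\alpha,\sigma_\alpha\rangle\,\alpha\,\langle\mu_\beta,\sigma_\beta\rangle\,\beta$; trail types $\mu ::= \bullet_\mu \mid \tau_1\to\langle\mu,\sigma\rangle\,\tau_2$; meta continuation types $\sigma ::= \bullet_\sigma \mid ((\tau_1\to\langle\mu_1,\sigma_1\rangle\,\tau_2)\times\mu_2)::\sigma_2$. A type environment $\Gamma$ assigns value types to variables.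 **Auxiliary constraints.** id-cont-type (a relation on $\tau,\mu,\sigma,\tau'$): - id-cont-type$(\tau,\bullet_\mu,\bullet_\sigma,\tau')$ iff $\tau=\tau'$; - id-cont-type$(\tau,\bullet_\mu,((\tau_1\to\langle\mu_1,\sigma_1\rangle\tau_1')\times\mu_2)::\sigma_2,\tau')$ iff $\tau=\tau_1$, $\tau'=\tau_1'$, $\mu_1=\mu_2$, $\sigma_1=\sigma_2$; - id-cont-type$(\tau,(\tau_1\to\langle\mu_1,\sigma_1\rangle\tau_1'),\sigma_2,\tau')$ iff $\tau=\tau_1$, $\tau'=\tau_1'$, $\mu_1=\bullet_\mu$, $\sigma_1=\sigma_2$. compatible (a relation on three trail types): - compatible$(\bullet_\mu,\mu_2,\mu_3)$ iff $\mu_2=\mu_3$; - compatible$((\tau_1\to\langle\mu_1,\sigma_1\rangle\tau_1'),\bullet_\mu,\mu_3)$ iff $(\tau_1\to\langle\mu_1,\sigma_1\rangle\tau_1')=\mu_3$; - compatible of two non-empty trail types and $\bullet_\mu$ is false; - compatible$((\tau_1\to\langle\mu_1,\sigma_1\rangle\tau_1'),(\tau_2\to\langle\mu_2,\sigma_2\rangle\tau_2'),(\tau_3\to\langle\mu_3,\sigma_3\rangle\tau_3'))$ iff $\tau_1=\tau_3$, $\tau_1'=\tau_3'$, $\sigma_1=\sigma_3$ and compatible$((\tau_2\to\langle\mu_2,\sigma_2\rangle\tau_2'),\mu_3,\mu_1)$. **Typing rules of $\lambda_D$** (judgment $\Gamma\vdash e:\tau\langle\mu_\alpha,\sigma_\alpha\rangle\alpha\langle\mu_\beta,\sigma_\beta\rangle\beta$):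 - Var: if $x:\tau\in\Gamma$ then $\Gamma\vdash x:\tau\langle\mu_\alpha,\sigma_\alpha\rangle\alpha\langle\mu_\alpha,\sigma_\alpha\rangle\alpha$. Num: $\Gamma\vdash n:\mathbb{N}\langle\mu_\alpha,\sigma_\alpha\rangle\alpha\langle\mu_\alpha,\sigma_\alpha\rangle\alpha$. - Lam: if $\Gamma,x:\tau_1\vdash e:\tau_2\langle\mu_\alpha,\sigma_\alpha\rangle\alpha\langle\mu_\beta,\sigma_\beta\rangle\beta$ then $\Gamma\vdash\lambda x.e:(\tau_1\to\tau_2\langle\mu_\alpha,\sigma_\alpha\rangle\alpha\langle\mu_\beta,\sigma_\beta\rangle\beta)\langle\mu_\gamma,\sigma_\gamma\rangle\gamma\langle\mu_\gamma,\sigma_\gamma\rangle\gamma$. - App: if $\Gamma\vdash e_1:(\tau_1\to\tau_2\langle\mu_\alpha,\sigma_\alpha\rangle\alpha\langle\mu_\beta,\sigma_\beta\rangle\beta)\langle\mu_\gamma,\sigma_\gamma\rangle\gamma\langle\mu_\delta,\sigma_\delta\rangle\delta$ and $\Gamma\vdash e_2:\tau_1\langle\mu_\beta,\sigma_\beta\rangle\beta\langle\mu_\gamma,\sigma_\gamma\rangle\gamma$ then $\Gamma\vdash e_1e_2:\tau_2\langle\mu_\alpha,\sigma_\alpha\rangle\alpha\langle\mu_\delta,\sigma_\delta\rangle\delta$. - Shift: if id-cont-type$(\gamma,\mu_{id},\sigma_{id},\gamma')$ and $\Gamma,k:\tau\to\tau_1\langle\mu_1,\sigma_1\rangle\tau_2\langle\mu_2,\sigma_2\rangle\alpha\vdash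 e:\gamma\langle\mu_{id},\sigma_{id}\rangle\gamma'\langle\bullet_\mu,\sigma_\beta\rangle\beta$ then $\Gamma\vdash\mathcal{S}k.e:\tau\langle\mu_\beta,((\tau_1\to\langle\mu_1,\sigma_1\rangle\tau_2)\times\mu_2)::\sigma_2\rangle\alpha\langle\mu_\beta,\sigma_\beta\rangle\beta$. - Control: if id-cont-type$(\gamma,\mu_{id},\sigma_{id},\gamma')$, compatible$((\tau_1\to\langle\mu_1,\sigma_1\rangle\tau_2),\mu_2,\mu_\gamma)$, compatible$(\mu_\beta,\mu_\gamma,\mu_\alpha)$ and $\Gamma,k:\tau\to\tau_1\langle\mu_1,\sigma_1\rangle\tau_2\langle\mu_2,\sigma_\alpha\rangle\alpha\vdash e:\gamma\langle\mu_{id},\sigma_{id}\rangle\gamma'\langle\bullet_\mu,\sigma_\beta\rangle\beta$ then $\Gamma\vdash\mathcal{F}k.e:\tau\langle\mu_\alpha,\sigma_\alpha\rangle\alpha\langle\mu_\beta,\sigma_\beta\rangle\beta$. - Shift0: if $\Gamma,k:\tau\to\tau_1\langle\mu_1,\sigma_1\rangle\tau_2\langle\mu_2,\sigma_2\rangle\alpha\vdash e:\tau_0\langle\mu_0,\sigma_0\rangle\tau_0'\langle\mu_0',\sigma_0'\rangle\beta$ then $\Gamma\vdash\mathcal{S}_0k.e:\tau\langle\mu_\beta,((\tau_1\to\langle\mu_1,\sigma_1\rangle\tau_2)\times\mu_2)::\sigma_2\rangle\alpha\langle\mu_\beta,((\tau_0\to\langle\mu_0,\sigma_0\rangle\tau_0')\times\mu_0')::\sigma_0'\rangle\beta$.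 - Control0: if compatible$((\tau_1\to\langle\mu_1,\sigma_1\rangle\tau_2),\mu_2,\mu_\gamma)$, compatible$(\mu_\beta,\mu_\gamma,\mu_\alpha)$ and $\Gamma,k:\tau\to\tau_1\langle\mu_1,\sigma_1\rangle\tau_2\langle\mu_2,\sigma_\alpha\rangle\alpha\vdash e:\tau_0\langle\mu_0,\sigma_0\rangle\tau_0'\langle\mu_0',\sigma_0'\rangle\beta$ then $\Gamma\vdash\mathcal{F}_0k.e:\tau\langle\mu_\alpha,\sigma_\alpha\rangle\alpha\langle\mu_\beta,((\tau_0\to\langle\mu_0,\sigma_0\rangle\tau_0')\times\mu_0')::\sigma_0'\rangle\beta$. - Prompt0: if id-cont-type$(\gamma,\mu_{id},\sigma_{id},\gamma')$ and $\Gamma\vdash e:\gamma\langle\mu_{id},\sigma_{id}\rangle\gamma'\langle\bullet_\mu,((\tau\to\langle\mu_\alpha,\sigma_\alpha\rangle\alpha)\times\mu_\beta)::\sigma_\beta\rangle\beta$ then $\Gamma\vdash\langle e\rangle:\tau\langle\mu_\alpha,\sigma_\alpha\rangle\alpha\langle\mu_\beta,\sigma_\beta\rangle\beta$. **Target language $\lambda_C$**: the standard simply-typed $\lambda$-calculus with types int, unit, $\tau_1\to\tau_2$, $\tau_1\times\tau_2$, with numbers, unit value $()$, pairs (and pair patterns), and a case analysis on whether an argument is $()$ or not; in typed use such a case analysis is resolved by the (known) types of the scrutinised trail and meta continuation (type unit, i.e. $\bullet^*$, versus non-unit). **Type translation.** $\mathbb{N}^*=\mathrm{int}$; $(\tau_1\to\tau_2\langle\mu_\alpha,\sigma_\alpha\rangle\alpha\langle\mu_\beta,\sigma_\beta\rangle\beta)^*=\tau_1^*\to(\tau_2^*\to\mu_\alpha^*\to\sigma_\alpha^*\to\alpha^*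 )\to\mu_\beta^*\to\sigma_\beta^*\to\beta^*$; $\bullet_\mu^*=\mathrm{unit}$; $(\tau_1\to\langle\mu,\sigma\rangle\tau_2)^*=\tau_1^*\to\mu^*\to\sigma^*\to\tau_2^*$; $\bullet_\sigma^*=\mathrm{unit}$; $(((\tau_1\to\langle\mu_1,\sigma_1\rangle\tau_2)\times\mu_2)::\sigma_2)^*=((\tau_1^*\to\mu_1^*\to\sigma_1^*\to\tau_2^* )\times\mu_2^* )\times\sigma_2^*$. $\Gamma^*$ is obtained by translating pointwise. **CPS interpreter.** It acts on typed terms (the case analyses in the auxiliary functions are selected by the types appearing in the derivation, according to id-cont-type and compatible). - $k_{id}=\lambda v.\lambda t.\lambda m.$ case $(t,m)$ of $((),())\Rightarrow v$; $((),((k_0,t_0),m_0))\Rightarrow k_0\,v\,t_0\,m_0$; otherwise ($t$ a non-empty trail) $\Rightarrow t\,v\,()\,m$. - $t_1@t_2$: $()@t_2=t_2$; $k@t_2=k::t_2$ for $k$ non-empty. - $k::t$: $k::()=k$; $k::t=\lambda v.\lambda t'.\lambda m'.\,k\,v\,(t::t')\,m'$ for $t$ non-empty. - $\mathcal{E}[\![x]\!]\rho\kappa=\lambda t.\lambda m.\kappa\,\rho(x)\,t\,m$; $\mathcal{E}[\![n]\!]\rho\kappa=\lambda t.\lambda m.\kappa\,n\,t\,m$; $\mathcal{E}[\![\lambda x.e]\!]\rho\kappa=\lambda t.\lambda m.\kappa\,(\lambda v.\mathcal{E}[\![e]\!]\rho[v/x])\,t\,m$. - $\mathcal{E}[\![e_1e_2]\!]\rho\kappa=\lambda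 t.\lambda m.\mathcal{E}[\![e_1]\!]\rho(\lambda v_1.\lambda t_1.\lambda m_1.\mathcal{E}[\![e_2]\!]\rho(\lambda v_2.\lambda t_2.\lambda m_2.v_1\,v_2\,\kappa\,t_2\,m_2)\,t_1\,m_1)\,t\,m$. - $\mathcal{E}[\![\mathcal{S}k.e]\!]\rho\kappa=\lambda t.\lambda m.\mathcal{E}[\![e]\!]\rho[(\lambda v.\lambda\kappa'.\lambda t'.\lambda m'.\kappa\,v\,t\,((\kappa',t'),m'))/k]\,k_{id}\,()\,m$. - $\mathcal{E}[\![\mathcal{F}k.e]\!]\rho\kappa=\lambda t.\lambda m.\mathcal{E}[\![e]\!]\rho[(\lambda v.\lambda\kappa'.\lambda t'.\lambda m'.\kappa\,v\,(t@(\kappa'::t'))\,m')/k]\,k_{id}\,()\,m$. - $\mathcal{E}[\![\mathcal{S}_0k.e]\!]\rho\kappa=\lambda t.\lambda((\kappa_0,t_0),m_0).\mathcal{E}[\![e]\!]\rho[(\lambda v.\lambda\kappa'.\lambda t'.\lambda m'.\kappa\,v\,t\,((\kappa',t'),m'))/k]\,\kappa_0\,t_0\,m_0$. - $\mathcal{E}[\![\mathcal{F}_0k.e]\!]\rho\kappa=\lambda t.\lambda((\kappa_0,t_0),m_0).\mathcal{E}[\![e]\!]\rho[(\lambda v.\lambda\kappa'.\lambda t'.\lambda m'.\kappa\,v\,(t@(\kappa'::t'))\,m')/k]\,\kappa_0\,t_0\,m_0$. - $\mathcal{E}[\![\langle e\rangle]\!]\rho\kappa=\lambda t.\lambda m.\mathcal{E}[\![e]\!]\rho\,k_{id}\,()\,((\kappa,t),m)$.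 Here $\mathcal{E}[\![e]\!]\rho$ is read as the function of $\kappa$ (i.e. $\lambda\kappa.\mathcal{E}[\![e]\!]\rho\kappa$). *)

theory Defs
  imports Main
begin

type_synonym var = string

datatype tm =
    Var var
  | Num nat
  | Lam var tm
  | App tm tm
  | Shift var tm
  | Control var tm
  | Shift0 var tm
  | Control0 var tm
  | Prompt tm

text \<open>
  Arguments come in the order in which they are written on paper:
  \<open>TFun \<tau>1 \<tau>2 \<mu>\<alpha> \<sigma>\<alpha> \<alpha> \<mu>\<beta> \<sigma>\<beta> \<beta>\<close> is \<open>\<tau>1 \<rightarrow> \<tau>2 \<langle>\<mu>\<alpha>,\<sigma>\<alpha>\<rangle> \<alpha> \<langle>\<mu>\<beta>,\<sigma>\<beta>\<rangle> \<beta>\<close>,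
  \<open>TrFun \<tau>1 \<mu> \<sigma> \<tau>2\<close> is \<open>\<tau>1 \<rightarrow> \<langle>\<mu>,\<sigma>\<rangle> \<tau>2\<close>, and
  \<open>MtCons \<tau>1 \<mu>1 \<sigma>1 \<tau>2 \<mu>2 \<sigma>2\<close> is \<open>((\<tau>1 \<rightarrow> \<langle>\<mu>1,\<sigma>1\<rangle> \<tau>2) \<times> \<mu>2) :: \<sigma>2\<close>.
\<close>

datatype ty = TNat | TFun ty ty tr mt ty tr mt ty
and tr = TrEmpty | TrFun ty tr mt ty
and mt = MtEmpty | MtCons ty tr mt ty tr mt

type_synonym tyenv = "var \<rightharpoonup> ty"

fun id_cont_type :: "ty \<Rightarrow> tr \<Rightarrow> mt \<Rightarrow> ty \<Rightarrow> bool" where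
  "id_cont_type \<tau> TrEmpty MtEmpty \<tau>' \<longleftrightarrow> \<tau> = \<tau>'"
| "id_cont_type \<tau> TrEmpty (MtCons \<tau>1 \<mu>1 \<sigma>1 \<tau>1' \<mu>2 \<sigma>2) \<tau>' \<longleftrightarrow>
     \<tau> = \<tau>1 \<and> \<tau>' = \<tau>1' \<and> \<mu>1 = \<mu>2 \<and> \<sigma>1 = \<sigma>2"
| "id_cont_type \<tau> (TrFun \<tau>1 \<mu>1 \<sigma>1 \<tau>1') \<sigma>2 \<tau>' \<longleftrightarrow>
     \<tau> = \<tau>1 \<and> \<tau>' = \<tau>1' \<and> \<mu>1 = TrEmpty \<and> \<sigma>1 = \<sigma>2"

function compatible :: "tr \<Rightarrow> tr \<Rightarrow> tr \<Rightarrow> bool" where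
  "compatible TrEmpty \<mu>2 \<mu>3 \<longleftrightarrow> \<mu>2 = \<mu>3"
| "compatible (TrFun \<tau>1 \<mu>1 \<sigma>1 \<tau>1') TrEmpty \<mu>3 \<longleftrightarrow> TrFun \<tau>1 \<mu>1 \<sigma>1 \<tau>1' = \<mu>3"
| "compatible (TrFun \<tau>1 \<mu>1 \<sigma>1 \<tau>1') (TrFun \<tau>2 \<mu>2 \<sigma>2 \<tau>2') TrEmpty \<longleftrightarrow> False"
| "compatible (TrFun \<tau>1 \<mu>1 \<sigma>1 \<tau>1') (TrFun \<tau>2 \<mu>2 \<sigma>2 \<tau>2') (TrFun \<tau>3 \<mu>3 \<sigma>3 \<tau>3') \<longleftrightarrow>
     \<tau>1 = \<tau>3 \<and> \<tau>1' = \<tau>3' \<and> \<sigma>1 = \<sigma>3 \<and> compatible (TrFun \<tau>2 \<mu>2 \<sigma>2 \<tau>2') \<mu>3 \<mu>1"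
  by pat_completeness auto
termination
  by (relation "measure (\<lambda>(\<mu>1, \<mu>2, \<mu>3). size \<mu>1 + size \<mu>2 + size \<mu>3)") auto

text \<open>
  A \<open>\<lambda>\<^sub>D\<close> term has several typing derivations, and the CPS interpreter depends on the derivation.
  The typing judgement therefore carries a derivation tree \<open>d\<close>; \<open>\<Gamma> \<turnstile> e \<Ztypecolon> \<dots>\<close> is derivable iff
  \<open>d \<rhd> \<Gamma> \<turnstile> e \<Ztypecolon> \<dots>\<close> for some \<open>d\<close>. Of the types that occur in a derivation, a tree
  records those which the side conditions \<open>id_cont_type\<close> and \<open>compatible\<close> constrain, since these
  select the cases of the auxiliary functions of the interpreter.
\<close>

datatype deriv =
    DVar var
  | DNum nat
  | DLam var deriv
  | DApp deriv deriv
  | DShift var "tr \<times> mt" deriv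
  | DControl var "tr \<times> mt" "tr \<times> tr \<times> tr" "tr \<times> tr \<times> tr" deriv
  | DShift0 var deriv
  | DControl0 var "tr \<times> tr \<times> tr" "tr \<times> tr \<times> tr" deriv
  | DPrompt "tr \<times> mt" deriv

inductive typing ::
  "deriv \<Rightarrow> tyenv \<Rightarrow> tm \<Rightarrow> ty \<Rightarrow> tr \<Rightarrow> mt \<Rightarrow> ty \<Rightarrow> tr \<Rightarrow> mt \<Rightarrow> ty \<Rightarrow> bool"
  ("_ \<rhd> _ \<turnstile> _ \<Ztypecolon> _ \<langle>_,_\<rangle> _ \<langle>_,_\<rangle> _" [51,51,51,51,0,0,51,0,0,51] 50)
where
  Var: "\<Gamma> x = Some \<tau> \<Longrightarrow>
    DVar x \<rhd> \<Gamma> \<turnstile> Var x \<Ztypecolon> \<tau> \<langle>\<mu>\<alpha>,\<sigma>\<alpha>\<rangle> \<alpha> \<langle>\<mu>\<alpha>,\<sigma>\<alpha>\<rangle> \<alpha>"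
| Num: "DNum n \<rhd> \<Gamma> \<turnstile> Num n \<Ztypecolon> TNat \<langle>\<mu>\<alpha>,\<sigma>\<alpha>\<rangle> \<alpha> \<langle>\<mu>\<alpha>,\<sigma>\<alpha>\<rangle> \<alpha>"
| Lam: "d \<rhd> \<Gamma>(x \<mapsto> \<tau>1) \<turnstile> e \<Ztypecolon> \<tau>2 \<langle>\<mu>\<alpha>,\<sigma>\<alpha>\<rangle> \<alpha> \<langle>\<mu>\<beta>,\<sigma>\<beta>\<rangle> \<beta> \<Longrightarrow>
    DLam x d \<rhd> \<Gamma> \<turnstile> Lam x e \<Ztypecolon> TFun \<tau>1 \<tau>2 \<mu>\<alpha> \<sigma>\<alpha> \<alpha> \<mu>\<beta> \<sigma>\<beta> \<beta> \<langle>\<mu>\<gamma>,\<sigma>\<gamma>\<rangle> \<gamma> \<langle>\<mu>\<gamma>,\<sigma>\<gamma>\<rangle> \<gamma>"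
| App: "d1 \<rhd> \<Gamma> \<turnstile> e1 \<Ztypecolon> TFun \<tau>1 \<tau>2 \<mu>\<alpha> \<sigma>\<alpha> \<alpha> \<mu>\<beta> \<sigma>\<beta> \<beta> \<langle>\<mu>\<gamma>,\<sigma>\<gamma>\<rangle> \<gamma> \<langle>\<mu>\<delta>,\<sigma>\<delta>\<rangle> \<delta> \<Longrightarrow>
    d2 \<rhd> \<Gamma> \<turnstile> e2 \<Ztypecolon> \<tau>1 \<langle>\<mu>\<beta>,\<sigma>\<beta>\<rangle> \<beta> \<langle>\<mu>\<gamma>,\<sigma>\<gamma>\<rangle> \<gamma> \<Longrightarrow>
    DApp d1 d2 \<rhd> \<Gamma> \<turnstile> App e1 e2 \<Ztypecolon> \<tau>2 \<langle>\<mu>\<alpha>,\<sigma>\<alpha>\<rangle> \<alpha> \<langle>\<mu>\<delta>,\<sigma>\<delta>\<rangle> \<delta>"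
| Shift: "id_cont_type \<gamma> \<mu>id \<sigma>id \<gamma>' \<Longrightarrow>
    d \<rhd> \<Gamma>(k \<mapsto> TFun \<tau> \<tau>1 \<mu>1 \<sigma>1 \<tau>2 \<mu>2 \<sigma>2 \<alpha>) \<turnstile> e \<Ztypecolon> \<gamma> \<langle>\<mu>id,\<sigma>id\<rangle> \<gamma>' \<langle>TrEmpty,\<sigma>\<beta>\<rangle> \<beta> \<Longrightarrow>
    DShift k (\<mu>id, \<sigma>id) d \<rhd>
      \<Gamma> \<turnstile> Shift k e \<Ztypecolon> \<tau> \<langle>\<mu>\<beta>,MtCons \<tau>1 \<mu>1 \<sigma>1 \<tau>2 \<mu>2 \<sigma>2\<rangle> \<alpha> \<langle>\<mu>\<beta>,\<sigma>\<beta>\<rangle> \<beta>"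
| Control: "id_cont_type \<gamma> \<mu>id \<sigma>id \<gamma>' \<Longrightarrow>
    compatible (TrFun \<tau>1 \<mu>1 \<sigma>1 \<tau>2) \<mu>2 \<mu>\<gamma> \<Longrightarrow>
    compatible \<mu>\<beta> \<mu>\<gamma> \<mu>\<alpha> \<Longrightarrow>
    d \<rhd> \<Gamma>(k \<mapsto> TFun \<tau> \<tau>1 \<mu>1 \<sigma>1 \<tau>2 \<mu>2 \<sigma>\<alpha> \<alpha>) \<turnstile> e \<Ztypecolon> \<gamma> \<langle>\<mu>id,\<sigma>id\<rangle> \<gamma>' \<langle>TrEmpty,\<sigma>\<beta>\<rangle> \<beta> \<Longrightarrow>
    DControl k (\<mu>id, \<sigma>id) (TrFun \<tau>1 \<mu>1 \<sigma>1 \<tau>2, \<mu>2, \<mu>\<gamma>) (\<mu>\<beta>, \<mu>\<gamma>, \<mu>\<alpha>) d \<rhd>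
      \<Gamma> \<turnstile> Control k e \<Ztypecolon> \<tau> \<langle>\<mu>\<alpha>,\<sigma>\<alpha>\<rangle> \<alpha> \<langle>\<mu>\<beta>,\<sigma>\<beta>\<rangle> \<beta>"
| Shift0:
   "d \<rhd> \<Gamma>(k \<mapsto> TFun \<tau> \<tau>1 \<mu>1 \<sigma>1 \<tau>2 \<mu>2 \<sigma>2 \<alpha>) \<turnstile> e \<Ztypecolon> \<tau>0 \<langle>\<mu>0,\<sigma>0\<rangle> \<tau>0' \<langle>\<mu>0',\<sigma>0'\<rangle> \<beta> \<Longrightarrow>
    DShift0 k d \<rhd>
      \<Gamma> \<turnstile> Shift0 k e \<Ztypecolon> \<tau> \<langle>\<mu>\<beta>,MtCons \<tau>1 \<mu>1 \<sigma>1 \<tau>2 \<mu>2 \<sigma>2\<rangle> \<alpha> \<langle>\<mu>\<beta>,MtCons \<tau>0 \<mu>0 \<sigma>0 \<tau>0' \<mu>0' \<sigma>0'\<rangle> \<beta>"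
| Control0: "compatible (TrFun \<tau>1 \<mu>1 \<sigma>1 \<tau>2) \<mu>2 \<mu>\<gamma> \<Longrightarrow>
    compatible \<mu>\<beta> \<mu>\<gamma> \<mu>\<alpha> \<Longrightarrow>
    d \<rhd> \<Gamma>(k \<mapsto> TFun \<tau> \<tau>1 \<mu>1 \<sigma>1 \<tau>2 \<mu>2 \<sigma>\<alpha> \<alpha>) \<turnstile> e \<Ztypecolon> \<tau>0 \<langle>\<mu>0,\<sigma>0\<rangle> \<tau>0' \<langle>\<mu>0',\<sigma>0'\<rangle> \<beta> \<Longrightarrow>
    DControl0 k (TrFun \<tau>1 \<mu>1 \<sigma>1 \<tau>2, \<mu>2, \<mu>\<gamma>) (\<mu>\<beta>, \<mu>\<gamma>, \<mu>\<alpha>) d \<rhd>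
      \<Gamma> \<turnstile> Control0 k e \<Ztypecolon> \<tau> \<langle>\<mu>\<alpha>,\<sigma>\<alpha>\<rangle> \<alpha> \<langle>\<mu>\<beta>,MtCons \<tau>0 \<mu>0 \<sigma>0 \<tau>0' \<mu>0' \<sigma>0'\<rangle> \<beta>"
| Prompt: "id_cont_type \<gamma> \<mu>id \<sigma>id \<gamma>' \<Longrightarrow>
    d \<rhd> \<Gamma> \<turnstile> e \<Ztypecolon> \<gamma> \<langle>\<mu>id,\<sigma>id\<rangle> \<gamma>' \<langle>TrEmpty,MtCons \<tau> \<mu>\<alpha> \<sigma>\<alpha> \<alpha> \<mu>\<beta> \<sigma>\<beta>\<rangle> \<beta> \<Longrightarrow>
    DPrompt (\<mu>id, \<sigma>id) d \<rhd> \<Gamma> \<turnstile> Prompt e \<Ztypecolon> \<tau> \<langle>\<mu>\<alpha>,\<sigma>\<alpha>\<rangle> \<alpha> \<langle>\<mu>\<beta>,\<sigma>\<beta>\<rangle> \<beta>"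

text \<open>
  Target variables are the source variables together with variables \<open>Adm s i\<close> for the binders
  that the interpreter introduces; \<open>s\<close> is a name and \<open>i\<close> an index that keeps them fresh.
\<close>

datatype cvar = Src var | Adm string nat

datatype cty = CInt | CUnit | CFun cty cty (infixr "\<rightarrow>\<^sub>C" 65) | CProd cty cty (infixr "\<times>\<^sub>C" 70)

text \<open>
  \<open>CSplit x y e1 e2\<close> is \<open>let (x, y) = e1 in e2\<close>, and
  \<open>CCase e e1 e2\<close> is \<open>case e of () \<Rightarrow> e1 | _ \<Rightarrow> e2\<close>.
\<close>

datatype ctm =
    CVar cvar
  | CNum int
  | CUnitV
  | CLam cvar ctm
  | CApp ctm ctm (infixl "\<cdot>" 100)
  | CPair ctm ctm
  | CSplit cvar cvar ctm ctm
  | CCase ctm ctm ctm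

text \<open>
  A case analysis is resolved by the type of its scrutinee: only the selected branch is typed.
  The interpreter below knows these types and emits the selected branch directly.
\<close>

inductive ctyping :: "(cvar \<rightharpoonup> cty) \<Rightarrow> ctm \<Rightarrow> cty \<Rightarrow> bool"
  ("_ \<turnstile>\<^sub>C _ \<Ztypecolon> _" [51,51,51] 50)
where
  "\<Delta> x = Some T \<Longrightarrow> \<Delta> \<turnstile>\<^sub>C CVar x \<Ztypecolon> T"
| "\<Delta> \<turnstile>\<^sub>C CNum n \<Ztypecolon> CInt"
| "\<Delta> \<turnstile>\<^sub>C CUnitV \<Ztypecolon> CUnit"
| "\<Delta>(x \<mapsto> T1) \<turnstile>\<^sub>C e \<Ztypecolon> T2 \<Longrightarrow> \<Delta> \<turnstile>\<^sub>C CLam x e \<Ztypecolon> T1 \<rightarrow>\<^sub>C T2"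
| "\<Delta> \<turnstile>\<^sub>C e1 \<Ztypecolon> T1 \<rightarrow>\<^sub>C T2 \<Longrightarrow> \<Delta> \<turnstile>\<^sub>C e2 \<Ztypecolon> T1 \<Longrightarrow> \<Delta> \<turnstile>\<^sub>C e1 \<cdot> e2 \<Ztypecolon> T2"
| "\<Delta> \<turnstile>\<^sub>C e1 \<Ztypecolon> T1 \<Longrightarrow> \<Delta> \<turnstile>\<^sub>C e2 \<Ztypecolon> T2 \<Longrightarrow> \<Delta> \<turnstile>\<^sub>C CPair e1 e2 \<Ztypecolon> T1 \<times>\<^sub>C T2"
| "\<Delta> \<turnstile>\<^sub>C e1 \<Ztypecolon> T1 \<times>\<^sub>C T2 \<Longrightarrow> \<Delta>(x \<mapsto> T1, y \<mapsto> T2) \<turnstile>\<^sub>C e2 \<Ztypecolon> T \<Longrightarrow> x \<noteq> y \<Longrightarrow> \<Delta> \<turnstile>\<^sub>C CSplit x y e1 e2 \<Ztypecolon> T"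
| "\<Delta> \<turnstile>\<^sub>C e \<Ztypecolon> CUnit \<Longrightarrow> \<Delta> \<turnstile>\<^sub>C e1 \<Ztypecolon> T \<Longrightarrow> \<Delta> \<turnstile>\<^sub>C CCase e e1 e2 \<Ztypecolon> T"
| "\<Delta> \<turnstile>\<^sub>C e \<Ztypecolon> S \<Longrightarrow> S \<noteq> CUnit \<Longrightarrow> \<Delta> \<turnstile>\<^sub>C e2 \<Ztypecolon> T \<Longrightarrow> \<Delta> \<turnstile>\<^sub>C CCase e e1 e2 \<Ztypecolon> T"

primrec trans_ty :: "ty \<Rightarrow> cty" and trans_tr :: "tr \<Rightarrow> cty" and trans_mt :: "mt \<Rightarrow> cty" where
  "trans_ty TNat = CInt"
| "trans_ty (TFun \<tau>1 \<tau>2 \<mu>\<alpha> \<sigma>\<alpha> \<alpha> \<mu>\<beta> \<sigma>\<beta> \<beta>) =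
     trans_ty \<tau>1 \<rightarrow>\<^sub>C (trans_ty \<tau>2 \<rightarrow>\<^sub>C trans_tr \<mu>\<alpha> \<rightarrow>\<^sub>C trans_mt \<sigma>\<alpha> \<rightarrow>\<^sub>C trans_ty \<alpha>) \<rightarrow>\<^sub>C
       trans_tr \<mu>\<beta> \<rightarrow>\<^sub>C trans_mt \<sigma>\<beta> \<rightarrow>\<^sub>C trans_ty \<beta>"
| "trans_tr TrEmpty = CUnit"
| "trans_tr (TrFun \<tau>1 \<mu> \<sigma> \<tau>2) = trans_ty \<tau>1 \<rightarrow>\<^sub>C trans_tr \<mu> \<rightarrow>\<^sub>C trans_mt \<sigma> \<rightarrow>\<^sub>C trans_ty \<tau>2"
| "trans_mt MtEmpty = CUnit"
| "trans_mt (MtCons \<tau>1 \<mu>1 \<sigma>1 \<tau>2 \<mu>2 \<sigma>2) =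
     ((trans_ty \<tau>1 \<rightarrow>\<^sub>C trans_tr \<mu>1 \<rightarrow>\<^sub>C trans_mt \<sigma>1 \<rightarrow>\<^sub>C trans_ty \<tau>2) \<times>\<^sub>C trans_tr \<mu>2) \<times>\<^sub>C trans_mt \<sigma>2"

fun trans_env :: "tyenv \<Rightarrow> cvar \<rightharpoonup> cty" where
  "trans_env \<Gamma> (Src x) = map_option trans_ty (\<Gamma> x)"
| "trans_env \<Gamma> (Adm s i) = None"

abbreviation av :: "string \<Rightarrow> nat \<Rightarrow> ctm" where
  "av s i \<equiv> CVar (Adm s i)"

abbreviation lams :: "string list \<Rightarrow> nat \<Rightarrow> ctm \<Rightarrow> ctm" where
  "lams ss i e \<equiv> foldr (\<lambda>s. CLam (Adm s i)) ss e"

text \<open>\<open>split_meta e i b\<close> is \<open>let ((k0, t0), m0) = e in b\<close>.\<close>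

abbreviation split_meta :: "ctm \<Rightarrow> nat \<Rightarrow> ctm \<Rightarrow> ctm" where
  "split_meta e i b \<equiv>
     CSplit (Adm ''p0'' i) (Adm ''m0'' i) e (CSplit (Adm ''k0'' i) (Adm ''t0'' i) (av ''p0'' i) b)"

text \<open>
  The auxiliary functions \<open>k\<^sub>i\<^sub>d\<close>, \<open>::\<close> and \<open>@\<close> are closed target functions. Their case analyses are
  resolved by the types at which they are used: the trail and meta continuation types of \<open>id_cont_type\<close>
  for \<open>k\<^sub>i\<^sub>d\<close>, and the three trail types of \<open>compatible\<close> (first argument, second argument, result) for
  \<open>::\<close> and \<open>@\<close>. The recursion of \<open>::\<close> follows that of \<open>compatible\<close>; the
  missing equations are for types that are not compatible, or for an empty first trail.
\<close>

fun kid :: "tr \<times> mt \<Rightarrow> ctm" where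
  "kid (TrEmpty, MtEmpty) = lams [''v'', ''t'', ''m''] 0 (av ''v'' 0)"
| "kid (TrEmpty, MtCons \<tau>1 \<mu>1 \<sigma>1 \<tau>2 \<mu>2 \<sigma>2) =
     lams [''v'', ''t'', ''m''] 0
       (split_meta (av ''m'' 0) 0 (av ''k0'' 0 \<cdot> av ''v'' 0 \<cdot> av ''t0'' 0 \<cdot> av ''m0'' 0))"
| "kid (TrFun \<tau>1 \<mu>1 \<sigma>1 \<tau>2, \<sigma>) =
     lams [''v'', ''t'', ''m''] 0 (av ''t'' 0 \<cdot> av ''v'' 0 \<cdot> CUnitV \<cdot> av ''m'' 0)"

function (sequential) tcons :: "tr \<times> tr \<times> tr \<Rightarrow> ctm" where
  "tcons (TrFun \<tau>1 \<mu>1 \<sigma>1 \<tau>1', TrEmpty, \<mu>3) = lams [''k'', ''t''] 0 (av ''k'' 0)"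
| "tcons (TrFun \<tau>1 \<mu>1 \<sigma>1 \<tau>1', TrFun \<tau>2 \<mu>2 \<sigma>2 \<tau>2', TrFun \<tau>3 \<mu>3 \<sigma>3 \<tau>3') =
     lams [''k'', ''t'', ''v'', ''t1'', ''m1''] 0
       (av ''k'' 0 \<cdot> av ''v'' 0 \<cdot>
         (tcons (TrFun \<tau>2 \<mu>2 \<sigma>2 \<tau>2', \<mu>3, \<mu>1) \<cdot> av ''t'' 0 \<cdot> av ''t1'' 0) \<cdot> av ''m1'' 0)"
  by pat_completeness auto
termination
  by (relation "measure (\<lambda>(\<mu>1, \<mu>2, \<mu>3). size \<mu>1 + size \<mu>2 + size \<mu>3)") auto

fun tappend :: "tr \<times> tr \<times> tr \<Rightarrow> ctm" where
  "tappend (TrEmpty, \<mu>2, \<mu>3) = lams [''t1'', ''t2''] 0 (av ''t2'' 0)"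
| "tappend (TrFun \<tau>1 \<mu>1 \<sigma>1 \<tau>1', \<mu>2, \<mu>3) = tcons (TrFun \<tau>1 \<mu>1 \<sigma>1 \<tau>1', \<mu>2, \<mu>3)"

text \<open>
  \<open>interp i d \<rho> \<kappa>\<close> is \<open>\<E>\<lbrakk>e\<rbrakk> \<rho> \<kappa>\<close>, where \<open>d\<close> derives a type of \<open>e\<close>. Fresh binders get the
  index \<open>i\<close>: the variables \<open>Adm s j\<close> free in \<open>\<kappa>\<close> or in \<open>\<rho>\<close> satisfy \<open>j < i\<close>, so no
  variable is captured (an environment that respects a type environment consists of closed terms).
\<close>

fun interp :: "nat \<Rightarrow> deriv \<Rightarrow> (var \<Rightarrow> ctm) \<Rightarrow> ctm \<Rightarrow> ctm" where
  "interp i (DVar x) \<rho> \<kappa> = lams [''t'', ''m''] i (\<kappa> \<cdot> \<rho> x \<cdot> av ''t'' i \<cdot> av ''m'' i)"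
| "interp i (DNum n) \<rho> \<kappa> = lams [''t'', ''m''] i (\<kappa> \<cdot> CNum (int n) \<cdot> av ''t'' i \<cdot> av ''m'' i)"
| "interp i (DLam x d) \<rho> \<kappa> =
     lams [''t'', ''m''] i
       (\<kappa> \<cdot> lams [''v'', ''k''] i (interp (Suc i) d (\<rho>(x := av ''v'' i)) (av ''k'' i))
          \<cdot> av ''t'' i \<cdot> av ''m'' i)"
| "interp i (DApp d1 d2) \<rho> \<kappa> =
     lams [''t'', ''m''] i
       (interp (Suc i) d1 \<rho>
          (lams [''v1'', ''t1'', ''m1''] i
            (interp (Suc i) d2 \<rho>
               (lams [''v2'', ''t2'', ''m2''] i
                 (av ''v1'' i \<cdot> av ''v2'' i \<cdot> \<kappa> \<cdot> av ''t2'' i \<cdot> av ''m2'' i))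
             \<cdot> av ''t1'' i \<cdot> av ''m1'' i))
        \<cdot> av ''t'' i \<cdot> av ''m'' i)"
| "interp i (DShift k ids d) \<rho> \<kappa> =
     lams [''t'', ''m''] i
       (interp (Suc i) d
          (\<rho>(k := lams [''v'', ''k1'', ''t1'', ''m1''] i
                    (\<kappa> \<cdot> av ''v'' i \<cdot> av ''t'' i
                       \<cdot> CPair (CPair (av ''k1'' i) (av ''t1'' i)) (av ''m1'' i))))
          (kid ids)
        \<cdot> CUnitV \<cdot> av ''m'' i)"
| "interp i (DControl k ids cs as d) \<rho> \<kappa> =
     lams [''t'', ''m''] i
       (interp (Suc i) d
          (\<rho>(k := lams [''v'', ''k1'', ''t1'', ''m1''] i
                    (\<kappa> \<cdot> av ''v'' i
                       \<cdot> (tappend as \<cdot> av ''t'' i \<cdot> (tcons cs \<cdot> av ''k1'' i \<cdot> av ''t1'' i))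
                       \<cdot> av ''m1'' i)))
          (kid ids)
        \<cdot> CUnitV \<cdot> av ''m'' i)"
| "interp i (DShift0 k d) \<rho> \<kappa> =
     lams [''t'', ''m''] i
       (split_meta (av ''m'' i) i
         (interp (Suc i) d
            (\<rho>(k := lams [''v'', ''k1'', ''t1'', ''m1''] i
                      (\<kappa> \<cdot> av ''v'' i \<cdot> av ''t'' i
                         \<cdot> CPair (CPair (av ''k1'' i) (av ''t1'' i)) (av ''m1'' i))))
            (av ''k0'' i)
          \<cdot> av ''t0'' i \<cdot> av ''m0'' i))"
| "interp i (DControl0 k cs as d) \<rho> \<kappa> =
     lams [''t'', ''m''] i
       (split_meta (av ''m'' i) i
         (interp (Suc i) d
            (\<rho>(k := lams [''v'', ''k1'', ''t1'', ''m1''] i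
                      (\<kappa> \<cdot> av ''v'' i
                         \<cdot> (tappend as \<cdot> av ''t'' i \<cdot> (tcons cs \<cdot> av ''k1'' i \<cdot> av ''t1'' i))
                         \<cdot> av ''m1'' i)))
            (av ''k0'' i)
          \<cdot> av ''t0'' i \<cdot> av ''m0'' i))"
| "interp i (DPrompt ids d) \<rho> \<kappa> =
     lams [''t'', ''m''] i
       (interp (Suc i) d \<rho> (kid ids) \<cdot> CUnitV \<cdot> CPair (CPair \<kappa> (av ''t'' i)) (av ''m'' i))"

text \<open>\<open>\<E>\<lbrakk>e\<rbrakk> \<rho>\<close> as a function of the continuation.\<close>

definition cps :: "deriv \<Rightarrow> (var \<Rightarrow> ctm) \<Rightarrow> ctm" where
  "cps d \<rho> = CLam (Adm ''k'' 0) (interp 1 d \<rho> (av ''k'' 0))"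

definition respects_env :: "(var \<Rightarrow> ctm) \<Rightarrow> (cvar \<rightharpoonup> cty) \<Rightarrow> bool" where
  "respects_env \<rho> \<Delta> \<longleftrightarrow> (\<forall>x T. \<Delta> (Src x) = Some T \<longrightarrow> Map.empty \<turnstile>\<^sub>C \<rho> x \<Ztypecolon> T)"

end

theory Submission
  imports Defs
begin

text \<open>
  The interpreter is typed by induction on the derivation, uniformly in the continuation, the
  environment and the target context. The context is only assumed to bind no \<open>Adm s j\<close> with
  \<open>j \<ge> i\<close>; then the binders of \<open>interp i\<close> extend it without shadowing, so weakening alone carries
  the typings of the continuation and of the environment under these binders.
\<close>

lemma ctyping_weaken:
  assumes "\<Delta> \<turnstile>\<^sub>C e \<Ztypecolon> T" and "\<Delta> \<subseteq>\<^sub>m \<Delta>'"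
  shows "\<Delta>' \<turnstile>\<^sub>C e \<Ztypecolon> T"
  using assms
proof (induction arbitrary: \<Delta>' rule: ctyping.induct)
  case (1 \<Delta> x T)
  then show ?case by (metis ctyping.intros(1) domI map_le_def)
next
  case (7 \<Delta> e1 T1 T2 x y e2 T)
  then show ?case by (blast intro: ctyping.intros(7) map_le_upd)
qed (auto intro: ctyping.intros map_le_upd)

lemma ctyping_CVar_iff: "\<Delta> \<turnstile>\<^sub>C CVar x \<Ztypecolon> T \<longleftrightarrow> \<Delta> x = Some T"
  by (auto intro: ctyping.intros elim: ctyping.cases)

lemma ctyping_CLam_iff: "\<Delta> \<turnstile>\<^sub>C CLam x e \<Ztypecolon> T \<longleftrightarrow> (\<exists>T1 T2. T = T1 \<rightarrow>\<^sub>C T2 \<and> \<Delta>(x \<mapsto> T1) \<turnstile>\<^sub>C e \<Ztypecolon> T2)"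
  by (auto intro: ctyping.intros elim: ctyping.cases)

lemma ctyping_CApp_iff: "\<Delta> \<turnstile>\<^sub>C e1 \<cdot> e2 \<Ztypecolon> T \<longleftrightarrow> (\<exists>T1. \<Delta> \<turnstile>\<^sub>C e1 \<Ztypecolon> T1 \<rightarrow>\<^sub>C T \<and> \<Delta> \<turnstile>\<^sub>C e2 \<Ztypecolon> T1)"
  by (auto intro: ctyping.intros elim: ctyping.cases)

lemma ctyping_CUnitV_iff: "\<Delta> \<turnstile>\<^sub>C CUnitV \<Ztypecolon> T \<longleftrightarrow> T = CUnit"
  by (auto intro: ctyping.intros elim: ctyping.cases)

lemma ctyping_CNum_iff: "\<Delta> \<turnstile>\<^sub>C CNum n \<Ztypecolon> T \<longleftrightarrow> T = CInt"
  by (auto intro: ctyping.intros elim: ctyping.cases)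

lemma ctyping_CPair_iff:
  "\<Delta> \<turnstile>\<^sub>C CPair e1 e2 \<Ztypecolon> T \<longleftrightarrow> (\<exists>T1 T2. T = T1 \<times>\<^sub>C T2 \<and> \<Delta> \<turnstile>\<^sub>C e1 \<Ztypecolon> T1 \<and> \<Delta> \<turnstile>\<^sub>C e2 \<Ztypecolon> T2)"
  by (auto intro: ctyping.intros elim: ctyping.cases)

lemma ctyping_CSplit_iff:
  "\<Delta> \<turnstile>\<^sub>C CSplit x y e1 e2 \<Ztypecolon> T \<longleftrightarrow>
     x \<noteq> y \<and> (\<exists>T1 T2. \<Delta> \<turnstile>\<^sub>C e1 \<Ztypecolon> T1 \<times>\<^sub>C T2 \<and> \<Delta>(x \<mapsto> T1, y \<mapsto> T2) \<turnstile>\<^sub>C e2 \<Ztypecolon> T)"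
  by (subst ctyping.simps) auto

text \<open>Each of these term formers has a single typing rule, so inversion is an equivalence and
  simplification can reduce the typing of a concrete target term to that of its parts.\<close>

lemmas ctyping_iffs = ctyping_CVar_iff ctyping_CLam_iff ctyping_CApp_iff ctyping_CUnitV_iff
  ctyping_CNum_iff ctyping_CPair_iff ctyping_CSplit_iff

text \<open>Each clause of \<open>id_cont_type\<close> supplies the type equations that make the
  selected branch well typed. \<open>kid\<close> yields closed terms, so \<Delta> is arbitrary and
  shadowing by the binders of index 0 is harmless.\<close>

lemma kid_typed:
  "id_cont_type \<tau> \<mu> \<sigma> \<tau>' \<Longrightarrow>
     \<Delta> \<turnstile>\<^sub>C kid (\<mu>, \<sigma>) \<Ztypecolon> trans_ty \<tau> \<rightarrow>\<^sub>C trans_tr \<mu> \<rightarrow>\<^sub>C trans_mt \<sigma> \<rightarrow>\<^sub>C trans_ty \<tau>'"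
  by (cases "(\<tau>, \<mu>, \<sigma>, \<tau>')" rule: id_cont_type.cases) (auto simp: ctyping_iffs)

text \<open>The recursive conjunct of \<open>compatible\<close> says that \<open>t :: t1\<close> has
  the trail type \<mu>1, which is what \<open>k\<close> expects as its trail. An empty first trail
  is excluded because \<open>tcons\<close> has no equation for it.\<close>

lemma tcons_typed:
  "compatible \<mu>1 \<mu>2 \<mu>3 \<Longrightarrow> \<mu>1 \<noteq> TrEmpty \<Longrightarrow>
     \<Delta> \<turnstile>\<^sub>C tcons (\<mu>1, \<mu>2, \<mu>3) \<Ztypecolon> trans_tr \<mu>1 \<rightarrow>\<^sub>C trans_tr \<mu>2 \<rightarrow>\<^sub>C trans_tr \<mu>3"
proof (induction \<mu>1 \<mu>2 \<mu>3 arbitrary: \<Delta> rule: compatible.induct)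
  case (4 \<tau>1 \<mu>1 \<sigma>1 \<tau>1' \<tau>2 \<mu>2 \<sigma>2 \<tau>2' \<tau>3 \<mu>3 \<sigma>3 \<tau>3')
  \<comment> \<open>The context must vary, since the recursive \<open>tcons\<close> stands under
    five binders of the outer one.\<close>
  then have "\<And>\<Delta>. \<Delta> \<turnstile>\<^sub>C tcons (TrFun \<tau>2 \<mu>2 \<sigma>2 \<tau>2', \<mu>3, \<mu>1) \<Ztypecolon>
      trans_tr (TrFun \<tau>2 \<mu>2 \<sigma>2 \<tau>2') \<rightarrow>\<^sub>C trans_tr \<mu>3 \<rightarrow>\<^sub>C trans_tr \<mu>1"
    by simp
  then show ?case
    using "4.prems" by (auto simp: ctyping_iffs)
qed (auto simp: ctyping_iffs)

lemma tappend_typed: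
  "compatible \<mu>1 \<mu>2 \<mu>3 \<Longrightarrow>
     \<Delta> \<turnstile>\<^sub>C tappend (\<mu>1, \<mu>2, \<mu>3) \<Ztypecolon> trans_tr \<mu>1 \<rightarrow>\<^sub>C trans_tr \<mu>2 \<rightarrow>\<^sub>C trans_tr \<mu>3"
  using tcons_typed[of \<mu>1 \<mu>2 \<mu>3 \<Delta>] by (cases \<mu>1) (auto simp: ctyping_iffs)

definition adm_fresh :: "nat \<Rightarrow> (cvar \<rightharpoonup> cty) \<Rightarrow> bool" where
  "adm_fresh i \<Delta> \<longleftrightarrow> (\<forall>s. \<forall>j\<ge>i. \<Delta> (Adm s j) = None)"

text \<open>The binders of one call of \<open>interp i\<close> share the index \<open>i\<close> and
  differ in their names. Freshness from \<open>Suc i\<close> on therefore survives any number of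
  them.\<close>

lemma adm_fresh_upd:
  "adm_fresh (Suc i) \<Delta> \<Longrightarrow> adm_fresh (Suc i) (\<Delta>(Adm s i \<mapsto> T))"
  by (auto simp: adm_fresh_def)

lemma adm_fresh_Suc: "adm_fresh i \<Delta> \<Longrightarrow> adm_fresh (Suc i) \<Delta>"
  by (auto simp: adm_fresh_def)

text \<open>Freshness is required of the original \<Delta> only, so the rule can be iterated over
  several binders of index \<open>i\<close>.\<close>

lemma map_le_adm_upd:
  "adm_fresh i \<Delta> \<Longrightarrow> \<Delta> \<subseteq>\<^sub>m \<Delta>' \<Longrightarrow> \<Delta> \<subseteq>\<^sub>m \<Delta>'(Adm s i \<mapsto> T)"
  by (auto simp: adm_fresh_def map_le_def)

text \<open>Unlike in \<open>respects_env\<close>, the values may be open: below binders \<rho>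
  holds administrative variables and captured continuations.\<close>

definition env_typed :: "(cvar \<rightharpoonup> cty) \<Rightarrow> (var \<Rightarrow> ctm) \<Rightarrow> tyenv \<Rightarrow> bool" where
  "env_typed \<Delta> \<rho> \<Gamma> \<longleftrightarrow> (\<forall>x \<tau>. \<Gamma> x = Some \<tau> \<longrightarrow> \<Delta> \<turnstile>\<^sub>C \<rho> x \<Ztypecolon> trans_ty \<tau>)"

lemma env_typed_upd:
  "env_typed \<Delta> \<rho> \<Gamma> \<Longrightarrow> \<Delta> \<turnstile>\<^sub>C v \<Ztypecolon> trans_ty \<tau> \<Longrightarrow> env_typed \<Delta> (\<rho>(x := v)) (\<Gamma>(x \<mapsto> \<tau>))"
  by (auto simp: env_typed_def)

lemma env_typed_weaken: "env_typed \<Delta> \<rho> \<Gamma> \<Longrightarrow> \<Delta> \<subseteq>\<^sub>m \<Delta>' \<Longrightarrow> env_typed \<Delta>' \<rho> \<Gamma>"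
  unfolding env_typed_def by (blast intro: ctyping_weaken)

lemmas trans_simps = trans_ty.simps trans_tr.simps trans_mt.simps

lemma interp_typed:
  assumes "d \<rhd> \<Gamma> \<turnstile> e \<Ztypecolon> \<tau> \<langle>\<mu>\<alpha>,\<sigma>\<alpha>\<rangle> \<alpha> \<langle>\<mu>\<beta>,\<sigma>\<beta>\<rangle> \<beta>"
    and "adm_fresh i \<Delta>"
    and "env_typed \<Delta> \<rho> \<Gamma>"
    and "\<Delta> \<turnstile>\<^sub>C \<kappa> \<Ztypecolon> trans_ty \<tau> \<rightarrow>\<^sub>C trans_tr \<mu>\<alpha> \<rightarrow>\<^sub>C trans_mt \<sigma>\<alpha> \<rightarrow>\<^sub>C trans_ty \<alpha>"
  shows "\<Delta> \<turnstile>\<^sub>C interp i d \<rho> \<kappa> \<Ztypecolon> trans_tr \<mu>\<beta> \<rightarrow>\<^sub>C trans_mt \<sigma>\<beta> \<rightarrow>\<^sub>C trans_ty \<beta>"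
  using assms
  \<comment> \<open>\<open>fun_upd_apply\<close> would turn the extended contexts into \<open>if\<close>-terms, which
    \<open>map_le_adm_upd\<close> and \<open>adm_fresh_upd\<close> do not match.\<close>
  supply fun_upd_apply [simp del] and fun_upd_same [simp] and fun_upd_other [simp]
    and ctyping_iffs [simp] and exI [intro!] and conjI [intro!]
    and adm_fresh_upd [intro!] and env_typed_upd [intro!]
proof (induction arbitrary: i \<Delta> \<rho> \<kappa> rule: typing.induct)
  case Var
  note w = map_le_adm_upd[OF Var.prems(1)]
  note k = ctyping_weaken[OF Var.prems(3)[unfolded trans_simps]]
  show ?case
    by (auto intro!: w k
      ctyping_weaken[OF Var.prems(2)[unfolded env_typed_def, rule_format, OF Var.hyps]])
next
  case Num
  note w = map_le_adm_upd[OF Num.prems(1)]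
  note k = ctyping_weaken[OF Num.prems(3)[unfolded trans_simps]]
  show ?case
    by (auto intro!: w k)
next
  case Lam
  note w = map_le_adm_upd[OF Lam.prems(1)]
  note k = ctyping_weaken[OF Lam.prems(3)[unfolded trans_simps]]
  show ?case
    by (auto intro!: w k Lam.IH[unfolded trans_simps] adm_fresh_Suc[OF Lam.prems(1)]
      env_typed_weaken[OF Lam.prems(2)])
next
  case App
  note w = map_le_adm_upd[OF App.prems(1)]
  note k = ctyping_weaken[OF App.prems(3)[unfolded trans_simps]]
  show ?case
    \<comment> \<open>The index \<open>Suc i\<close> serves both calls: the continuation containing
      the call on \<open>d2\<close> is typed in a context that extends \<Delta> by binders of index
      \<open>i\<close> only, not by those inside the call on \<open>d1\<close>.\<close>
    by (auto intro!: w k App.IH[unfolded trans_simps] adm_fresh_Suc[OF App.prems(1)]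
      env_typed_weaken[OF App.prems(2)])
next
  case Shift
  note w = map_le_adm_upd[OF Shift.prems(1)]
  note k = ctyping_weaken[OF Shift.prems(3)[unfolded trans_simps]]
  show ?case
    by (auto intro!: w k kid_typed[OF Shift.hyps(1)] Shift.IH[unfolded trans_simps]
      adm_fresh_Suc[OF Shift.prems(1)] env_typed_weaken[OF Shift.prems(2)])
next
  case Control
  note w = map_le_adm_upd[OF Control.prems(1)]
  note k = ctyping_weaken[OF Control.prems(3)[unfolded trans_simps]]
  show ?case
    \<comment> \<open>The trail types inside \<open>t @ (k1 :: t1)\<close> are still unknown after
      \<open>auto\<close>. The type of \<kappa> fixes the result \<mu>\<alpha>, then
      \<open>tappend\<close> fixes the intermediate \<mu>\<gamma>, and \<open>tcons\<close> has to
      produce that type.\<close>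
    by (auto intro!: w kid_typed[OF Control.hyps(1)] Control.IH[unfolded trans_simps]
      adm_fresh_Suc[OF Control.prems(1)] env_typed_weaken[OF Control.prems(2)])
      (rule k, (rule w map_le_refl)+, rule tappend_typed[OF Control.hyps(3)],
        rule tcons_typed[OF Control.hyps(2), simplified])
next
  case Shift0
  note w = map_le_adm_upd[OF Shift0.prems(1)]
  note k = ctyping_weaken[OF Shift0.prems(3)[unfolded trans_simps]]
  show ?case
    by (auto intro!: w k Shift0.IH[unfolded trans_simps] adm_fresh_Suc[OF Shift0.prems(1)]
      env_typed_weaken[OF Shift0.prems(2)])
next
  case Control0
  note w = map_le_adm_upd[OF Control0.prems(1)]
  note k = ctyping_weaken[OF Control0.prems(3)[unfolded trans_simps]]
  show ?case
    by (auto intro!: w Control0.IH[unfolded trans_simps] adm_fresh_Suc[OF Control0.prems(1)]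
      env_typed_weaken[OF Control0.prems(2)])
      (rule k, (rule w map_le_refl)+, rule tappend_typed[OF Control0.hyps(2)],
        rule tcons_typed[OF Control0.hyps(1), simplified])
next
  case Prompt
  note w = map_le_adm_upd[OF Prompt.prems(1)]
  note k = ctyping_weaken[OF Prompt.prems(3)[unfolded trans_simps]]
  show ?case
    by (auto intro!: w k kid_typed[OF Prompt.hyps(1)] Prompt.IH[unfolded trans_simps]
      adm_fresh_Suc[OF Prompt.prems(1)] env_typed_weaken[OF Prompt.prems(2)])
qed

theorem theorem4p1:
  fixes \<Gamma> :: tyenv and e :: tm and d :: deriv and \<rho> :: "var \<Rightarrow> ctm"
    and \<tau> \<alpha> \<beta> :: ty and \<mu>\<alpha> \<mu>\<beta> :: tr and \<sigma>\<alpha> \<sigma>\<beta> :: mt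
  assumes "d \<rhd> \<Gamma> \<turnstile> e \<Ztypecolon> \<tau> \<langle>\<mu>\<alpha>,\<sigma>\<alpha>\<rangle> \<alpha> \<langle>\<mu>\<beta>,\<sigma>\<beta>\<rangle> \<beta>"
    and "respects_env \<rho> (trans_env \<Gamma>)"
  shows "trans_env \<Gamma> \<turnstile>\<^sub>C cps d \<rho> \<Ztypecolon>
           (trans_ty \<tau> \<rightarrow>\<^sub>C trans_tr \<mu>\<alpha> \<rightarrow>\<^sub>C trans_mt \<sigma>\<alpha> \<rightarrow>\<^sub>C trans_ty \<alpha>) \<rightarrow>\<^sub>C
             trans_tr \<mu>\<beta> \<rightarrow>\<^sub>C trans_mt \<sigma>\<beta> \<rightarrow>\<^sub>C trans_ty \<beta>"
proof -
  let ?K = "trans_ty \<tau> \<rightarrow>\<^sub>C trans_tr \<mu>\<alpha> \<rightarrow>\<^sub>C trans_mt \<sigma>\<alpha> \<rightarrow>\<^sub>C trans_ty \<alpha>"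
  let ?\<Delta> = "(trans_env \<Gamma>)(Adm ''k'' 0 \<mapsto> ?K)"
  \<comment> \<open>The values of \<rho> are typed in the empty context, which lies below every
    context.\<close>
  have "env_typed ?\<Delta> \<rho> \<Gamma>"
    using assms(2) ctyping_weaken[OF _ map_le_empty] by (auto simp: env_typed_def respects_env_def)
  \<comment> \<open>\<open>trans_env\<close> binds no administrative variable, so
    \<open>Adm ''k'' 0\<close> is the only one and index 1 is fresh.\<close>
  moreover have "adm_fresh 1 ?\<Delta>"
    by (simp add: adm_fresh_def)
  ultimately have "?\<Delta> \<turnstile>\<^sub>C interp 1 d \<rho> (av ''k'' 0) \<Ztypecolon>
      trans_tr \<mu>\<beta> \<rightarrow>\<^sub>C trans_mt \<sigma>\<beta> \<rightarrow>\<^sub>C trans_ty \<beta>"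
    by (intro interp_typed[OF assms(1)]) (simp_all add: ctyping_CVar_iff)
  then show ?thesis
    unfolding cps_def by (rule ctyping.intros)
qed

end
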